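(* The alternating group $A_6$ has a strongly real (unmixed) Beauville structure of type $((4,4,4),(5,5,5))$.
   Context: Let $G$ be a finite group. An unmixed Beauville structure of $G$ is a pair of generating sets $\{x_i,y_i,z_i\}\subset G$, $i=1,2$ (each of which generates $G$), with orders $l_i=o(x_i)$, $m_i=o(y_i)$, $n_i=o(z_i)$, such that: (1) $x_iy_iz_i=1$ for $i=1,2$; (2) $\frac{1}{l_i}+\frac{1}{m_i}+\frac{1}{n_i}<1$ for $i=1,2$; (3) setting $\Sigma(x,y,z):=\bigcup_{g\in G}\bigcup_{j=0}^{\infty}\{gx^jg^{-1},gy^jg^{-1},gz^jg^{-1}\}$, one has $\Sigma(x_1,y_1,z_1)\cap\Sigma(x_2,y_2,z_2)=\{e\}$, where $e$ is the identity of $G$. Its type is $((l_1,m_1,n_1),(l_2,m_2,n_2))$. Such a structure is strongly real if there exist automorphisms $\phi_1,\phi_2\in\mathrm{Aut}(G)$ that differ only by an inner automorphism of $G$ such that $x_i^{\phi_i}=x_i^{-1}$ and $y_i^{\phi_i}=y_i^{-1}$ for $i=1,2$. *)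

theory Defs
  imports Complex_Main "HOL-Algebra.Algebra"
begin

definition beauville_Sigma :: "('a, 'b) monoid_scheme \<Rightarrow> 'a \<times> 'a \<times> 'a \<Rightarrow> 'a set" where
  "beauville_Sigma G = (\<lambda>(x, y, z).
     (\<Union>g \<in> carrier G. \<Union>j::nat.
        {g \<otimes>\<^bsub>G\<^esub> (x [^]\<^bsub>G\<^esub> j) \<otimes>\<^bsub>G\<^esub> (inv\<^bsub>G\<^esub> g),
         g \<otimes>\<^bsub>G\<^esub> (y [^]\<^bsub>G\<^esub> j) \<otimes>\<^bsub>G\<^esub> (inv\<^bsub>G\<^esub> g),
         g \<otimes>\<^bsub>G\<^esub> (z [^]\<^bsub>G\<^esub> j) \<otimes>\<^bsub>G\<^esub> (inv\<^bsub>G\<^esub> g)}))"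

definition triple_type :: "('a, 'b) monoid_scheme \<Rightarrow> 'a \<times> 'a \<times> 'a \<Rightarrow> nat \<times> nat \<times> nat" where
  "triple_type G = (\<lambda>(x, y, z). (group.ord G x, group.ord G y, group.ord G z))"

definition hyperbolic_generating_triple :: "('a, 'b) monoid_scheme \<Rightarrow> 'a \<times> 'a \<times> 'a \<Rightarrow> bool" where
  "hyperbolic_generating_triple G = (\<lambda>(x, y, z).
     {x, y, z} \<subseteq> carrier G \<and>
     generate G {x, y, z} = carrier G \<and>
     x \<otimes>\<^bsub>G\<^esub> y \<otimes>\<^bsub>G\<^esub> z = \<one>\<^bsub>G\<^esub> \<and>
     1 / real (group.ord G x) + 1 / real (group.ord G y) + 1 / real (group.ord G z) < 1)"

text \<open>A structure is a pair \<open>(T\<^sub>1, T\<^sub>2)\<close> of ordered triples, since both the product relation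
  and the type depend on the order of the generators.\<close>

definition unmixed_beauville_structure ::
    "('a, 'b) monoid_scheme \<Rightarrow> ('a \<times> 'a \<times> 'a) \<times> ('a \<times> 'a \<times> 'a) \<Rightarrow> bool" where
  "unmixed_beauville_structure G = (\<lambda>(T\<^sub>1, T\<^sub>2).
     group G \<and> finite (carrier G) \<and>
     hyperbolic_generating_triple G T\<^sub>1 \<and>
     hyperbolic_generating_triple G T\<^sub>2 \<and>
     beauville_Sigma G T\<^sub>1 \<inter> beauville_Sigma G T\<^sub>2 = {\<one>\<^bsub>G\<^esub>})"

definition structure_type ::
    "('a, 'b) monoid_scheme \<Rightarrow> ('a \<times> 'a \<times> 'a) \<times> ('a \<times> 'a \<times> 'a)
      \<Rightarrow> (nat \<times> nat \<times> nat) \<times> (nat \<times> nat \<times> nat)" where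
  "structure_type G = (\<lambda>(T\<^sub>1, T\<^sub>2). (triple_type G T\<^sub>1, triple_type G T\<^sub>2))"

text \<open>Elements of \<^const>\<open>auto\<close> are extensional on the carrier, so inner automorphisms have to be
  restricted to it as well.\<close>

definition inner_auto :: "('a, 'b) monoid_scheme \<Rightarrow> ('a \<Rightarrow> 'a) set" where
  "inner_auto G = {\<lambda>x \<in> carrier G. g \<otimes>\<^bsub>G\<^esub> x \<otimes>\<^bsub>G\<^esub> (inv\<^bsub>G\<^esub> g) | g. g \<in> carrier G}"

text \<open>Inner automorphisms form a normal subgroup of the automorphism group, so it does not
  matter on which side \<open>\<iota>\<close> is multiplied below.\<close>

definition strongly_real ::
    "('a, 'b) monoid_scheme \<Rightarrow> ('a \<times> 'a \<times> 'a) \<times> ('a \<times> 'a \<times> 'a) \<Rightarrow> bool" where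
  "strongly_real G = (\<lambda>((x\<^sub>1, y\<^sub>1, z\<^sub>1), (x\<^sub>2, y\<^sub>2, z\<^sub>2)).
     \<exists>\<phi>\<^sub>1 \<in> auto G. \<exists>\<phi>\<^sub>2 \<in> auto G.
       (\<exists>\<iota> \<in> inner_auto G. \<phi>\<^sub>2 = \<iota> \<otimes>\<^bsub>AutoGroup G\<^esub> \<phi>\<^sub>1) \<and>
       \<phi>\<^sub>1 x\<^sub>1 = inv\<^bsub>G\<^esub> x\<^sub>1 \<and> \<phi>\<^sub>1 y\<^sub>1 = inv\<^bsub>G\<^esub> y\<^sub>1 \<and>
       \<phi>\<^sub>2 x\<^sub>2 = inv\<^bsub>G\<^esub> x\<^sub>2 \<and> \<phi>\<^sub>2 y\<^sub>2 = inv\<^bsub>G\<^esub> y\<^sub>2)"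

end

theory Submission
  imports Defs
begin

text \<open>The structure is given by two explicit triples of permutations of \<open>{1..6}\<close>, with products
  read as composition of functions:
    \<open>x\<^sub>1 = (1 2)(3 4 5 6)\<close>, \<open>y\<^sub>1 = (1 4)(2 3 5 6)\<close>, \<open>z\<^sub>1 = (2 4)(1 6 3 5)\<close> and
    \<open>x\<^sub>2 = (1 2 3 4 6)\<close>, \<open>y\<^sub>2 = (1 5 3 6 2)\<close>, \<open>z\<^sub>2 = (1 3 6 4 5)\<close>.
  The two sets of conjugates of powers meet only in the identity, because elements of the
  first have order dividing \<open>4\<close> and elements of the second have order dividing \<open>5\<close> (\<open>Sigma_inter_coprime\<close>).

  Generation comes down to three-cycles. A subgroup containing \<open>(a b i)\<close> for one fixed pair
  \<open>a, b\<close> and all other \<open>i\<close> is the whole alternating group (\<open>alt_group_eq_if_pair_cycles\<close>). In each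
  triple a word of length four in the generators is a three-cycle, and its conjugates by \<open>x\<^sub>1\<close>
  or \<open>x\<^sub>2\<close> supply the rest.

  The substance is strong reality. No permutation of the six points, even or odd, inverts both
  \<open>x\<^sub>i\<close> and \<open>y\<^sub>i\<close>; an automorphism of \<open>A\<^sub>6\<close> that does not come from \<open>S\<^sub>6\<close> is needed. Sylvester's
  construction provides one. The 15 pairs of points can be arranged in six ways into five
  perfect matchings, the synthematic totals, and permutations of points permute these six
  totals. After labelling the totals by \<open>1, ..., 6\<close>, sending a permutation of the points to the
  permutation it induces on labels is a homomorphism. The labelling is chosen so that each of
  \<open>x\<^sub>1, y\<^sub>1, x\<^sub>2, y\<^sub>2\<close> induces its own inverse (\<open>generators_act_on_totals\<close>). A homomorphism that
  inverts a generating set is an involution, hence an automorphism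
  (\<open>hom_inverting_generators_in_auto\<close>). The same automorphism inverts both pairs, so the inner
  automorphism relating \<open>\<phi>\<^sub>1\<close> and \<open>\<phi>\<^sub>2\<close> can be taken to be the identity.\<close>

section \<open>Generators of alternating groups\<close>

lemma three_cycle_apply:
  assumes "distinct [a, b, c]"
  shows "cycle_of_list [a, b, c] a = b" "cycle_of_list [a, b, c] b = c" "cycle_of_list [a, b, c] c = a"
    and "d \<notin> {a, b, c} \<Longrightarrow> cycle_of_list [a, b, c] d = d"
  using assms by (auto simp: transpose_def)

lemma three_cycle_rotate: "distinct [a, b, c] \<Longrightarrow> cycle_of_list [b, c, a] = cycle_of_list [a, b, c]"
  using cycle_of_list_rotate_independent[of "[a, b, c]" 1] by simp

lemma three_cycle_square:
  "distinct [a, b, c] \<Longrightarrow> cycle_of_list [a, b, c] \<circ> cycle_of_list [a, b, c] = cycle_of_list [c, b, a]"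
  by (auto simp: fun_eq_iff transpose_def)

text \<open>Conjugation acts on cycles entry by entry, so from here on a cycle is kept as a list of
  entries instead of being expanded into transpositions.\<close>

declare cycle_of_list.simps [simp del]

lemma alt_subgroup_closed:
  assumes "subgroup H (alt_group n)"
  shows "\<And>p. p \<in> H \<Longrightarrow> p permutes {1..n}"
    and "\<And>p q. \<lbrakk>p \<in> H; q \<in> H\<rbrakk> \<Longrightarrow> p \<circ> q \<in> H"
    and "\<And>p. p \<in> H \<Longrightarrow> inv' p \<in> H"
proof -
  show perm: "p permutes {1..n}" if "p \<in> H" for p
    using subgroup.mem_carrier[OF assms that] by (simp add: alt_group_carrier)
  show "p \<circ> q \<in> H" if "p \<in> H" "q \<in> H" for p q
    using subgroup.m_closed[OF assms that] by (simp add: alt_group_mult)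
  show "inv' p \<in> H" if "p \<in> H" for p
    using subgroup.m_inv_closed[OF assms that]
      alt_group_inv_equality[OF subgroup.mem_carrier[OF assms that]] by simp
qed

lemma three_cycle_conjugate:
  assumes "subgroup H (alt_group n)" "p \<in> H" "cycle_of_list [a, b, c] \<in> H" "distinct [a, b, c]"
  shows "cycle_of_list [p a, p b, p c] \<in> H"
proof -
  have "p \<circ> cycle_of_list [a, b, c] \<circ> inv' p = cycle_of_list (map p [a, b, c])"
    by (rule conjugation_of_cycle[OF assms(4)])
      (use alt_subgroup_closed(1)[OF assms(1,2)] permutes_bij in blast)
  moreover have "p \<circ> cycle_of_list [a, b, c] \<circ> inv' p \<in> H"
    using alt_subgroup_closed(2,3)[OF assms(1)] assms(2,3) by blast
  ultimately show ?thesis by simp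
qed

text \<open>The square of a three-cycle is its inverse, and \<open>(c b a)\<close> rotates to \<open>(b a c)\<close>.\<close>

lemma three_cycle_inverse:
  assumes "subgroup H (alt_group n)" "cycle_of_list [a, b, c] \<in> H" "distinct [a, b, c]"
  shows "cycle_of_list [b, a, c] \<in> H"
proof -
  have "cycle_of_list [c, b, a] \<in> H"
    using three_cycle_square[OF assms(3)] alt_subgroup_closed(2)[OF assms(1) assms(2) assms(2)]
    by simp
  then show ?thesis
    using three_cycle_rotate[of c b a] assms(3) by simp
qed

text \<open>Conjugating \<open>(a d c)\<close> by \<open>(a b c)\<close> gives \<open>(b d a)\<close>, which is \<open>(a b d)\<close> up to rotation. Repeated
  use turns a chain of cycles through \<open>a\<close>, each sharing a point with the next, into cycles
  through the pair \<open>a, b\<close>.\<close>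

lemma three_cycle_chain:
  assumes "subgroup H (alt_group n)" "cycle_of_list [a, b, c] \<in> H" "cycle_of_list [a, d, c] \<in> H"
    and "distinct [a, b, c, d]"
  shows "cycle_of_list [a, b, d] \<in> H"
proof -
  have "cycle_of_list [b, d, a] \<in> H"
    using three_cycle_conjugate[OF assms(1-3)] assms(4) three_cycle_apply[of a b c] by simp
  then show ?thesis
    using three_cycle_rotate[of a b d] assms(4) by simp
qed

text \<open>Conjugating the given cycles by one another frees first one and then both of the fixed
  entries \<open>a, b\<close>: \<open>(a b i)\<close> takes \<open>(a b j)\<close> to \<open>(b i j)\<close>, and \<open>(a b k)\<close> takes \<open>(b i j)\<close> to \<open>(k i j)\<close>.
  So all three-cycles are present, and these generate the alternating group.\<close>

lemma alt_group_eq_if_pair_cycles: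
  assumes H: "subgroup H (alt_group n)" and ab: "a \<noteq> b"
    and pair: "\<And>i. \<lbrakk>i \<in> {1..n}; i \<noteq> a; i \<noteq> b\<rbrakk> \<Longrightarrow> cycle_of_list [a, b, i] \<in> H"
  shows "H = carrier (alt_group n)"
proof
  show "H \<subseteq> carrier (alt_group n)"
    using H by (rule subgroup.subset)
  have pair': "cycle_of_list [b, a, i] \<in> H" if "i \<in> {1..n}" "i \<noteq> a" "i \<noteq> b" for i
    using three_cycle_inverse[OF H pair[OF that]] that ab by auto
  have b_fixed: "cycle_of_list [b, i, j] \<in> H"
    if "i \<in> {1..n}" "j \<in> {1..n}" "distinct [a, b, i, j]" for i j
    using three_cycle_conjugate[OF H pair[of i] pair[of j]] that
    by (force simp: three_cycle_apply)
  have a_fixed: "cycle_of_list [a, i, j] \<in> H"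
    if "i \<in> {1..n}" "j \<in> {1..n}" "distinct [a, b, i, j]" for i j
    using three_cycle_conjugate[OF H pair'[of i] pair'[of j]] that
    by (force simp: three_cycle_apply)
  have neither: "cycle_of_list [k, i, j] \<in> H"
    if "i \<in> {1..n}" "j \<in> {1..n}" "k \<in> {1..n}" "distinct [a, b, i, j, k]" for i j k
    using three_cycle_conjugate[OF H pair[of k] b_fixed[of i j]] that
    by (force simp: three_cycle_apply)
  have from_a: "cycle_of_list [a, i, j] \<in> H"
    if "i \<in> {1..n}" "j \<in> {1..n}" "distinct [a, i, j]" for i j
    using pair[of j] pair'[of i] three_cycle_rotate[of b a i] a_fixed[of i j] that ab
    by (cases "i = b"; cases "j = b") auto
  have from_b: "cycle_of_list [b, i, j] \<in> H"
    if "i \<in> {1..n}" "j \<in> {1..n}" "distinct [b, i, j]" "a \<noteq> i" "a \<noteq> j" for i j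
    using b_fixed[of i j] that ab by simp
  have "three_cycles n \<subseteq> H"
  proof
    fix p
    assume "p \<in> three_cycles n"
    then obtain cs where cs: "p = cycle_of_list cs" "cycle cs" "length cs = 3" "set cs \<subseteq> {1..n}"
      by blast
    obtain i j k where ijk: "cs = [i, j, k]"
      using stupid_lemma[OF cs(3)] by blast
    have rot: "cycle_of_list [i, j, k] = cycle_of_list [j, k, i]"
      "cycle_of_list [i, j, k] = cycle_of_list [k, i, j]"
      using three_cycle_rotate[of i j k] three_cycle_rotate[of k i j] cs(2) ijk by simp_all
    consider "i = a" | "j = a" | "k = a" | "a \<notin> {i, j, k}" "i = b" | "a \<notin> {i, j, k}" "j = b"
      | "a \<notin> {i, j, k}" "k = b" | "a \<notin> {i, j, k}" "b \<notin> {i, j, k}"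
      by blast
    then have "cycle_of_list [i, j, k] \<in> H"
    proof cases
      case 1
      then show ?thesis using from_a[of j k] cs ijk by simp
    next
      case 2
      then show ?thesis using from_a[of k i] cs ijk unfolding rot(1) by simp
    next
      case 3
      then show ?thesis using from_a[of i j] cs ijk unfolding rot(2) by simp
    next
      case 4
      then show ?thesis using from_b[of j k] cs ijk by simp
    next
      case 5
      then show ?thesis using from_b[of k i] cs ijk unfolding rot(1) by simp
    next
      case 6
      then show ?thesis using from_b[of i j] cs ijk unfolding rot(2) by simp
    next
      case 7
      then show ?thesis using neither[of j k i] cs ijk ab by auto
    qed
    then show "p \<in> H"
      using cs(1) ijk by simp
  qed
  then show "carrier (alt_group n) \<subseteq> H"
    using group.generate_subgroup_incl[OF alt_group_is_group _ H]
    by (simp add: alt_group_carrier_as_three_cycles)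
qed

section \<open>The two generating triples\<close>

lemma one_to_six: "{1..6::nat} = {1, 2, 3, 4, 5, 6}"
  by auto

lemma permutes_six_eqI:
  assumes "p permutes {1..6::nat}" "q permutes {1..6}"
    and "map p [1, 2, 3, 4, 5, 6] = map q [1, 2, 3, 4, 5, 6]"
  shows "p = q"
proof
  fix i
  show "p i = q i"
    using assms(3) permutes_not_in[OF assms(1), of i] permutes_not_in[OF assms(2), of i]
    unfolding one_to_six by (cases "i \<in> {1, 2, 3, 4, 5, 6}") auto
qed

definition x\<^sub>1 :: "nat \<Rightarrow> nat" where "x\<^sub>1 = cycle_of_list [1, 2] \<circ> cycle_of_list [3, 4, 5, 6]"
definition y\<^sub>1 :: "nat \<Rightarrow> nat" where "y\<^sub>1 = cycle_of_list [1, 4] \<circ> cycle_of_list [2, 3, 5, 6]"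
definition z\<^sub>1 :: "nat \<Rightarrow> nat" where "z\<^sub>1 = cycle_of_list [2, 4] \<circ> cycle_of_list [1, 6, 3, 5]"
definition x\<^sub>2 :: "nat \<Rightarrow> nat" where "x\<^sub>2 = cycle_of_list [1, 2, 3, 4, 6]"
definition y\<^sub>2 :: "nat \<Rightarrow> nat" where "y\<^sub>2 = cycle_of_list [1, 5, 3, 6, 2]"
definition z\<^sub>2 :: "nat \<Rightarrow> nat" where "z\<^sub>2 = cycle_of_list [1, 3, 6, 4, 5]"

lemmas generator_defs = x\<^sub>1_def y\<^sub>1_def z\<^sub>1_def x\<^sub>2_def y\<^sub>2_def z\<^sub>2_def

lemma generator_values:
  "x\<^sub>1 1 = 2" "x\<^sub>1 2 = 1" "x\<^sub>1 3 = 4" "x\<^sub>1 4 = 5" "x\<^sub>1 5 = 6" "x\<^sub>1 6 = 3"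
  "y\<^sub>1 1 = 4" "y\<^sub>1 2 = 3" "y\<^sub>1 3 = 5" "y\<^sub>1 4 = 1" "y\<^sub>1 5 = 6" "y\<^sub>1 6 = 2"
  "z\<^sub>1 1 = 6" "z\<^sub>1 2 = 4" "z\<^sub>1 3 = 5" "z\<^sub>1 4 = 2" "z\<^sub>1 5 = 1" "z\<^sub>1 6 = 3"
  "x\<^sub>2 1 = 2" "x\<^sub>2 2 = 3" "x\<^sub>2 3 = 4" "x\<^sub>2 4 = 6" "x\<^sub>2 5 = 5" "x\<^sub>2 6 = 1"
  "y\<^sub>2 1 = 5" "y\<^sub>2 2 = 1" "y\<^sub>2 3 = 6" "y\<^sub>2 4 = 4" "y\<^sub>2 5 = 3" "y\<^sub>2 6 = 2"
  "z\<^sub>2 1 = 3" "z\<^sub>2 2 = 2" "z\<^sub>2 3 = 6" "z\<^sub>2 4 = 5" "z\<^sub>2 5 = 1" "z\<^sub>2 6 = 4"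
  by (simp_all add: generator_defs cycle_of_list.simps transpose_def)

text \<open>The simplifier rewrites \<open>1\<close> to \<open>Suc 0\<close> on natural numbers; keeping the tables in both forms
  lets them match before and after that step.\<close>

lemmas generator_tables = generator_values generator_values[simplified]

lemma generators_permute:
  "x\<^sub>1 permutes {1..6}" "y\<^sub>1 permutes {1..6}" "z\<^sub>1 permutes {1..6}"
  "x\<^sub>2 permutes {1..6}" "y\<^sub>2 permutes {1..6}" "z\<^sub>2 permutes {1..6}"
  unfolding generator_defs
  by (auto intro!: permutes_compose permutes_subset[OF cycle_permutes])

lemma generators_carrier:
  "{x\<^sub>1, y\<^sub>1, z\<^sub>1, x\<^sub>2, y\<^sub>2, z\<^sub>2} \<subseteq> carrier (alt_group 6)"
proof -
  have "evenperm x\<^sub>1" "evenperm y\<^sub>1" "evenperm z\<^sub>1" "evenperm x\<^sub>2" "evenperm y\<^sub>2" "evenperm z\<^sub>2"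
    by (simp_all add: generator_defs cycle_of_list.simps evenperm_comp evenperm_swap permutation_compose
        permutation_swap_id)
  with generators_permute show ?thesis
    by (simp add: alt_group_carrier)
qed

lemma generator_products:
  "x\<^sub>1 \<circ> y\<^sub>1 \<circ> z\<^sub>1 = id" "x\<^sub>2 \<circ> y\<^sub>2 \<circ> z\<^sub>2 = id"
  by (rule permutes_six_eqI; (intro permutes_compose permutes_id generators_permute)?; simp add: generator_tables)+

lemma three_cycle_words:
  "x\<^sub>1 \<circ> x\<^sub>1 \<circ> z\<^sub>1 \<circ> y\<^sub>1 = cycle_of_list [1, 2, 3]"
  "x\<^sub>2 \<circ> z\<^sub>2 \<circ> y\<^sub>2 \<circ> y\<^sub>2 = cycle_of_list [5, 6, 4]"
proof -
  have c: "cycle_of_list [1, 2, 3] permutes {1..6::nat}" "cycle_of_list [5, 6, 4] permutes {1..6::nat}"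
    by (auto intro!: permutes_subset[OF cycle_permutes])
  show "x\<^sub>1 \<circ> x\<^sub>1 \<circ> z\<^sub>1 \<circ> y\<^sub>1 = cycle_of_list [1, 2, 3]"
    by (rule permutes_six_eqI[OF _ c(1)])
      (simp_all add: permutes_compose generators_permute generator_tables cycle_of_list.simps transpose_def
        del: One_nat_def)
  show "x\<^sub>2 \<circ> z\<^sub>2 \<circ> y\<^sub>2 \<circ> y\<^sub>2 = cycle_of_list [5, 6, 4]"
    by (rule permutes_six_eqI[OF _ c(2)])
      (simp_all add: permutes_compose generators_permute generator_tables cycle_of_list.simps transpose_def
        del: One_nat_def)
qed

text \<open>\<open>x\<^sub>1\<close> swaps \<open>1\<close> and \<open>2\<close> and rotates \<open>3, 4, 5, 6\<close>. Conjugating \<open>(1 2 i)\<close> by it and inverting therefore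
  advances only the third entry, so the single cycle \<open>(1 2 3)\<close> produces all \<open>(1 2 i)\<close>.\<close>

lemma generate_first:
  "generate (alt_group 6) {x\<^sub>1, y\<^sub>1} = carrier (alt_group 6)" (is "?H = _")
proof -
  have H: "subgroup ?H (alt_group 6)"
    using group.generate_is_subgroup[OF alt_group_is_group] generators_carrier by simp
  note closed = alt_subgroup_closed(2,3)[OF H]
  have xy: "x\<^sub>1 \<in> ?H" "y\<^sub>1 \<in> ?H"
    by (simp_all add: generate.incl)
  have "z\<^sub>1 = inv' (x\<^sub>1 \<circ> y\<^sub>1)"
    using generator_products(1)
    by (metis generators_permute(1,2) permutes_compose permutes_inv_o(2) comp_assoc id_comp comp_id)
  then have z: "z\<^sub>1 \<in> ?H"
    using closed(2)[OF closed(1)[OF xy]] by simp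
  have c3: "cycle_of_list [1, 2, 3] \<in> ?H"
    using closed(1) xy z unfolding three_cycle_words(1)[symmetric] by simp
  have step: "cycle_of_list [1, 2, x\<^sub>1 i] \<in> ?H"
    if "cycle_of_list [1, 2, i] \<in> ?H" "i \<in> {3, 4, 5, 6}" for i
    using three_cycle_inverse[OF H three_cycle_conjugate[OF H xy(1) that(1)]] that(2)
    by (auto simp: generator_tables)
  have c4: "cycle_of_list [1, 2, 4] \<in> ?H"
    using step[OF c3] by (simp add: generator_tables)
  have c5: "cycle_of_list [1, 2, 5] \<in> ?H"
    using step[OF c4] by (simp add: generator_tables)
  have c6: "cycle_of_list [1, 2, 6] \<in> ?H"
    using step[OF c5] by (simp add: generator_tables)
  show ?thesis
    by (rule alt_group_eq_if_pair_cycles[OF H, of 1 2])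
      (use c3 c4 c5 c6 in \<open>unfold one_to_six, auto\<close>)
qed

text \<open>\<open>x\<^sub>2\<close> fixes \<open>5\<close> and rotates the other points, and the three-cycle at hand is \<open>(5 6 4)\<close> with
  \<open>6 = x\<^sub>2 4\<close>. Its conjugates by powers of \<open>x\<^sub>2\<close> form a chain of cycles through \<open>5\<close> in which
  neighbours share a point, and \<open>three_cycle_chain\<close> turns them into the cycles \<open>(5 6 i)\<close>.\<close>

lemma generate_second:
  "generate (alt_group 6) {x\<^sub>2, y\<^sub>2} = carrier (alt_group 6)" (is "?H = _")
proof -
  have H: "subgroup ?H (alt_group 6)"
    using group.generate_is_subgroup[OF alt_group_is_group] generators_carrier by simp
  note closed = alt_subgroup_closed(2,3)[OF H]
  have xy: "x\<^sub>2 \<in> ?H" "y\<^sub>2 \<in> ?H"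
    by (simp_all add: generate.incl)
  have "z\<^sub>2 = inv' (x\<^sub>2 \<circ> y\<^sub>2)"
    using generator_products(2)
    by (metis generators_permute(4,5) permutes_compose permutes_inv_o(2) comp_assoc id_comp comp_id)
  then have z: "z\<^sub>2 \<in> ?H"
    using closed(2)[OF closed(1)[OF xy]] by simp
  have c64: "cycle_of_list [5, 6, 4] \<in> ?H"
    using closed(1) xy z unfolding three_cycle_words(2)[symmetric] by simp
  have step: "cycle_of_list [5, x\<^sub>2 i, x\<^sub>2 j] \<in> ?H"
    if "cycle_of_list [5, i, j] \<in> ?H" "distinct [5, i, j]" for i j
    using three_cycle_conjugate[OF H xy(1) that] by (simp add: generator_tables)
  have c16: "cycle_of_list [5, 1, 6] \<in> ?H"
    using step[OF c64] by (simp add: generator_tables)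
  have c21: "cycle_of_list [5, 2, 1] \<in> ?H"
    using step[OF c16] by (simp add: generator_tables)
  have c32: "cycle_of_list [5, 3, 2] \<in> ?H"
    using step[OF c21] by (simp add: generator_tables)
  \<comment> \<open>\<open>(5 1 6)\<close> is the inverse of \<open>(5 6 1)\<close>, from which the chain runs through \<open>1, 2, 3\<close>.\<close>
  have d1: "cycle_of_list [5, 6, 1] \<in> ?H"
    using three_cycle_inverse[OF H, of 6 5 1] c16 three_cycle_rotate[of 5 "1::nat" 6]
      three_cycle_rotate[of "1::nat" 6 5] by simp
  have d2: "cycle_of_list [5, 6, 2] \<in> ?H"
    using three_cycle_chain[OF H d1 c21] by simp
  have d3: "cycle_of_list [5, 6, 3] \<in> ?H"
    using three_cycle_chain[OF H d2 c32] by simp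
  show ?thesis
    by (rule alt_group_eq_if_pair_cycles[OF H, of 5 6])
      (use c64 d1 d2 d3 in \<open>unfold one_to_six, auto\<close>)
qed

section \<open>The exotic automorphism\<close>

text \<open>Row \<open>i\<close> is one of the six synthematic totals: five perfect matchings of \<open>{1..6}\<close> which together
  use each of the 15 pairs once. The order of the rows matters: it is the labelling under
  which \<open>generators_act_on_totals\<close> holds.\<close>

definition total :: "nat \<Rightarrow> nat set set set" where
  "total i =
    [{{{1,2},{3,5},{4,6}}, {{1,3},{2,4},{5,6}}, {{1,4},{2,5},{3,6}}, {{1,5},{2,6},{3,4}}, {{1,6},{2,3},{4,5}}},
     {{{1,2},{3,5},{4,6}}, {{1,3},{2,6},{4,5}}, {{1,4},{2,3},{5,6}}, {{1,5},{2,4},{3,6}}, {{1,6},{2,5},{3,4}}},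
     {{{1,2},{3,6},{4,5}}, {{1,3},{2,4},{5,6}}, {{1,4},{2,6},{3,5}}, {{1,5},{2,3},{4,6}}, {{1,6},{2,5},{3,4}}},
     {{{1,2},{3,4},{5,6}}, {{1,3},{2,6},{4,5}}, {{1,4},{2,5},{3,6}}, {{1,5},{2,3},{4,6}}, {{1,6},{2,4},{3,5}}},
     {{{1,2},{3,6},{4,5}}, {{1,3},{2,5},{4,6}}, {{1,4},{2,3},{5,6}}, {{1,5},{2,6},{3,4}}, {{1,6},{2,4},{3,5}}},
     {{{1,2},{3,4},{5,6}}, {{1,3},{2,5},{4,6}}, {{1,4},{2,6},{3,5}}, {{1,5},{2,4},{3,6}}, {{1,6},{2,3},{4,5}}}]
    ! (i - 1)"

definition move_total :: "(nat \<Rightarrow> nat) \<Rightarrow> nat set set set \<Rightarrow> nat set set set" where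
  "move_total p = (`) ((`) ((`) p))"

lemma inj_total: "inj_on total {1..6}"
proof -
  have "distinct (map total [1, 2, 3, 4, 5, 6])" by code_simp
  moreover have "set [1, 2, 3, 4, 5, 6] = {1..6::nat}" by auto
  ultimately show ?thesis by (metis distinct_map)
qed

text \<open>Such a \<open>p\<close> takes row \<open>p i\<close> to row \<open>i\<close>, so on labels it induces its own inverse. In the proof,
  rewriting with \<open>insert_commute\<close> sorts the nested finite sets, so that equal totals become
  syntactically equal.\<close>

lemma generators_act_on_totals:
  "\<forall>i\<in>{1..6}. move_total x\<^sub>1 (total (x\<^sub>1 i)) = total i"
  "\<forall>i\<in>{1..6}. move_total y\<^sub>1 (total (y\<^sub>1 i)) = total i"
  "\<forall>i\<in>{1..6}. move_total x\<^sub>2 (total (x\<^sub>2 i)) = total i"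
  "\<forall>i\<in>{1..6}. move_total y\<^sub>2 (total (y\<^sub>2 i)) = total i"
  unfolding one_to_six by (simp_all add: generator_tables move_total_def total_def insert_commute)

text \<open>The graph of the exotic automorphism: \<open>q\<close> is the permutation of labels induced by \<open>p\<close>. As a
  relation it is visibly compatible with products and inverses, and that every element of \<open>A\<^sub>6\<close>
  maps totals to totals needs to be checked for generators only.\<close>

definition realises :: "(nat \<Rightarrow> nat) \<Rightarrow> (nat \<Rightarrow> nat) \<Rightarrow> bool" where
  "realises p q \<longleftrightarrow> q \<in> carrier (alt_group 6) \<and> (\<forall>i\<in>{1..6}. move_total p (total i) = total (q i))"

lemma image_fun_comp: "(`) (f \<circ> g) = (`) f \<circ> (`) g"
  by (simp add: fun_eq_iff image_comp)

lemma move_total_comp: "move_total (p \<circ> q) T = move_total p (move_total q T)"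
  by (simp add: move_total_def image_fun_comp)

lemma move_total_id: "move_total id T = T"
  by (simp add: move_total_def)

lemma alt_group_mem_iff: "q \<in> carrier (alt_group n) \<Longrightarrow> q i \<in> {1..n} \<longleftrightarrow> i \<in> {1..n}"
  by (metis alt_group_carrier permutes_in_image)

lemma realises_comp:
  assumes "realises p q" "realises p' q'"
  shows "realises (p \<circ> p') (q \<circ> q')"
proof -
  have "q \<circ> q' \<in> carrier (alt_group 6)"
    using assms monoid.m_closed[OF group.is_monoid[OF alt_group_is_group], of q 6 q']
    by (simp add: realises_def alt_group_mult)
  moreover have "move_total (p \<circ> p') (total i) = total ((q \<circ> q') i)" if "i \<in> {1..6}" for i
  proof -
    have "q' i \<in> {1..6}"
      using assms(2) that alt_group_mem_iff by (simp add: realises_def del: atLeastAtMost_iff)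
    then show ?thesis
      using assms that by (simp add: realises_def move_total_comp del: atLeastAtMost_iff)
  qed
  ultimately show ?thesis
    by (simp add: realises_def)
qed

lemma realises_inv:
  assumes "realises p q" "p \<in> carrier (alt_group 6)"
  shows "realises (inv' p) (inv' q)"
proof -
  have q: "q \<in> carrier (alt_group 6)"
    using assms(1) by (simp add: realises_def)
  note inv_q = alt_group_inv_closed[OF q]
  have "bij p" "bij q"
    using assms(2) q permutes_bij by (auto simp: alt_group_carrier)
  have "move_total (inv' p) (total i) = total (inv' q i)" if i: "i \<in> {1..6}" for i
  proof -
    have "inv' q i \<in> {1..6}"
      using alt_group_mem_iff[OF inv_q] i by blast
    then have "move_total p (total (inv' q i)) = total (q (inv' q i))"
      using assms(1) by (simp add: realises_def)
    then have "move_total (inv' p) (total i) = move_total (inv' p \<circ> p) (total (inv' q i))"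
      using \<open>bij q\<close> by (simp add: move_total_comp bij_is_surj surj_f_inv_f)
    then show ?thesis
      using \<open>bij p\<close> by (simp add: bij_is_inj move_total_id)
  qed
  with inv_q show ?thesis
    by (simp add: realises_def)
qed

lemma realises_unique:
  assumes "realises p q" "realises p q'"
  shows "q = q'"
proof
  fix i
  have q: "q permutes {1..6}" "q' permutes {1..6}"
    using assms by (auto simp: realises_def alt_group_carrier)
  show "q i = q' i"
  proof (cases "i \<in> {1..6}")
    case True
    then have "total (q i) = total (q' i)"
      using assms by (simp add: realises_def)
    then show ?thesis
      using inj_total True permutes_in_image[OF q(1)] permutes_in_image[OF q(2)]
      by (auto dest: inj_onD)
  next
    case False
    then show ?thesis
      using permutes_not_in[OF q(1)] permutes_not_in[OF q(2)] by simp
  qed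
qed

lemma realises_inverse_of_generator:
  assumes "p \<in> carrier (alt_group 6)" "\<forall>i\<in>{1..6}. move_total p (total (p i)) = total i"
  shows "realises p (inv' p)"
proof -
  have "move_total p (total i) = total (inv' p i)" if "i \<in> {1..6}" for i
  proof -
    have "inv' p i \<in> {1..6}"
      by (rule alt_group_mem_iff[OF alt_group_inv_closed[OF assms(1)], THEN iffD2, OF that])
    with assms(2) have "move_total p (total (p (inv' p i))) = total (inv' p i)"
      by (rule bspec)
    moreover have "p (inv' p i) = i"
      using assms(1) permutes_inverses(1)[of p "{1..6}" i] by (simp add: alt_group_carrier)
    ultimately show ?thesis
      by simp
  qed
  then show ?thesis
    using alt_group_inv_closed[OF assms(1)] by (simp add: realises_def)
qed

lemma generators_realise_inverses:
  "realises x\<^sub>1 (inv' x\<^sub>1)" "realises y\<^sub>1 (inv' y\<^sub>1)"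
  "realises x\<^sub>2 (inv' x\<^sub>2)" "realises y\<^sub>2 (inv' y\<^sub>2)"
  using realises_inverse_of_generator generators_carrier generators_act_on_totals by auto

lemma realises_exists:
  assumes "p \<in> carrier (alt_group 6)"
  shows "\<exists>q. realises p q"
proof -
  have "p \<in> generate (alt_group 6) {x\<^sub>1, y\<^sub>1}"
    using assms generate_first by simp
  then show ?thesis
  proof (induction rule: generate.induct)
    case one
    have "realises id id"
      using monoid.one_closed[OF group.is_monoid[OF alt_group_is_group], of 6]
      by (simp add: realises_def move_total_id alt_group_one)
    then show ?case
      unfolding alt_group_one by blast
  next
    case (incl h)
    then show ?case
      using generators_realise_inverses by blast
  next
    case (inv h)
    then have h: "h \<in> carrier (alt_group 6)" and "\<exists>q. realises h q"
      using generators_carrier generators_realise_inverses by blast+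
    then show ?case
      unfolding alt_group_inv_equality[OF h] using realises_inv by blast
  next
    case (eng h1 h2)
    then show ?case
      unfolding alt_group_mult using realises_comp by blast
  qed
qed

text \<open>It sends three-cycles to products of two disjoint three-cycles, so it is not conjugation by
  any permutation of the points.\<close>

definition exotic :: "(nat \<Rightarrow> nat) \<Rightarrow> nat \<Rightarrow> nat" where
  "exotic = (\<lambda>p \<in> carrier (alt_group 6). THE q. realises p q)"

lemma exotic_eqI: "\<lbrakk>p \<in> carrier (alt_group 6); realises p q\<rbrakk> \<Longrightarrow> exotic p = q"
  unfolding exotic_def using realises_unique by auto

lemma realises_exotic: "p \<in> carrier (alt_group 6) \<Longrightarrow> realises p (exotic p)"
  using realises_exists exotic_eqI by metis

lemma exotic_hom: "exotic \<in> hom (alt_group 6) (alt_group 6)"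
proof (rule homI)
  fix p q
  assume pq: "p \<in> carrier (alt_group 6)" "q \<in> carrier (alt_group 6)"
  then show "exotic p \<in> carrier (alt_group 6)"
    using realises_exotic realises_def by blast
  have "p \<circ> q \<in> carrier (alt_group 6)"
    using monoid.m_closed[OF group.is_monoid[OF alt_group_is_group] pq] by (simp add: alt_group_mult)
  then show "exotic (p \<otimes>\<^bsub>alt_group 6\<^esub> q) = exotic p \<otimes>\<^bsub>alt_group 6\<^esub> exotic q"
    unfolding alt_group_mult by (intro exotic_eqI realises_comp realises_exotic pq)
qed

lemma exotic_inverts:
  assumes "p \<in> {x\<^sub>1, y\<^sub>1, x\<^sub>2, y\<^sub>2}"
  shows "exotic p = inv\<^bsub>alt_group 6\<^esub> p"
proof -
  have "p \<in> carrier (alt_group 6)" "realises p (inv' p)"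
    using assms generators_carrier generators_realise_inverses by auto
  then show ?thesis
    by (simp add: exotic_eqI alt_group_inv_equality)
qed

text \<open>Applying \<open>h\<close> twice fixes every generator, so \<open>h\<close> is its own inverse and in particular
  bijective.\<close>

lemma (in group) hom_inverting_generators_in_auto:
  assumes h: "h \<in> hom G G" "h \<in> extensional (carrier G)"
    and S: "S \<subseteq> carrier G" "generate G S = carrier G"
    and inverts: "\<And>s. s \<in> S \<Longrightarrow> h s = inv s"
  shows "h \<in> auto G"
proof -
  interpret h: group_hom G G h
    using h(1) by unfold_locales
  have invol: "h (h g) = g" if "g \<in> generate G S" for g
    using that
  proof (induction rule: generate.induct)
    case one
    then show ?case by simp
  next
    case (incl s)
    then have "s \<in> carrier G" using S(1) by blast
    then show ?case using inverts[OF incl] by simp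
  next
    case (inv s)
    then have "s \<in> carrier G" using S(1) by blast
    then show ?case using inverts[OF inv] by simp
  next
    case (eng g1 g2)
    then show ?case using S by simp
  qed
  have "bij_betw h (carrier G) (carrier G)"
    using h.hom_closed invol S(2) by (intro bij_betw_byWitness[where f' = h]) auto
  then show ?thesis
    using h by (simp add: auto_def Bij_def)
qed

lemma exotic_in_auto: "exotic \<in> auto (alt_group 6)"
proof (rule group.hom_inverting_generators_in_auto[OF alt_group_is_group exotic_hom])
  show "exotic \<in> extensional (carrier (alt_group 6))"
    by (simp add: exotic_def)
  show "generate (alt_group 6) {x\<^sub>1, y\<^sub>1} = carrier (alt_group 6)"
    by (rule generate_first)
qed (use generators_carrier exotic_inverts in auto)

text \<open>Conjugation by the identity is the unit of the automorphism group, so one automorphism can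
  serve as both \<open>\<phi>\<^sub>1\<close> and \<open>\<phi>\<^sub>2\<close>.\<close>

lemma (in group) auto_eq_inner_mult_self:
  assumes "f \<in> auto G"
  shows "\<exists>\<iota>\<in>inner_auto G. f = \<iota> \<otimes>\<^bsub>AutoGroup G\<^esub> f"
proof
  let ?i = "\<lambda>x \<in> carrier G. \<one> \<otimes> x \<otimes> inv \<one>"
  show "?i \<in> inner_auto G"
    unfolding inner_auto_def by blast
  have i: "?i = \<one>\<^bsub>AutoGroup G\<^esub>"
    by (auto simp: AutoGroup_def BijGroup_def fun_eq_iff restrict_def)
  show "f = ?i \<otimes>\<^bsub>AutoGroup G\<^esub> f"
    unfolding i using monoid.l_one[OF group.is_monoid[OF AutoGroup], of f] assms
    by (simp add: AutoGroup_def)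
qed

section \<open>Orders and conjugates of powers\<close>

lemma (in group) ord_eq_prime_power:
  assumes "a \<in> carrier G" "Factorial_Ring.prime (p::nat)" "a [^] (p ^ Suc k) = \<one>" "a [^] (p ^ k) \<noteq> \<one>"
  shows "ord a = p ^ Suc k"
proof -
  obtain i where i: "i \<le> Suc k" "ord a = p ^ i"
    using assms(1,2,3) divides_primepow_nat pow_eq_id by blast
  have "\<not> i \<le> k"
    using assms(1,4) i(2) le_imp_power_dvd pow_eq_id by metis
  with i show ?thesis
    using le_Suc_eq by blast
qed

lemma alt_group_nat_pow: "p [^]\<^bsub>alt_group n\<^esub> (k::nat) = p ^^ k"
  by (induction k)
    (simp_all add: nat_pow_def alt_group_one alt_group_mult funpow_Suc_right del: funpow.simps)

lemma fourth_powers: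
  "x\<^sub>1 ^^ 4 = id" "y\<^sub>1 ^^ 4 = id" "z\<^sub>1 ^^ 4 = id"
proof -
  have pow4: "p ^^ 4 = p \<circ> p \<circ> p \<circ> p" for p :: "nat \<Rightarrow> nat"
    by (simp add: eval_nat_numeral comp_assoc)
  show "x\<^sub>1 ^^ 4 = id" "y\<^sub>1 ^^ 4 = id" "z\<^sub>1 ^^ 4 = id"
    unfolding pow4
    by (rule permutes_six_eqI; (intro permutes_compose permutes_id generators_permute)?; simp add: generator_tables)+
qed

lemma fifth_powers:
  "x\<^sub>2 ^^ 5 = id" "y\<^sub>2 ^^ 5 = id" "z\<^sub>2 ^^ 5 = id"
proof -
  have five: "cycle_of_list cs ^^ 5 = id" if "cycle cs" "length cs = 5" for cs :: "nat list"
    using cycle_is_id_root[OF that(1)] that(2) by simp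
  show "x\<^sub>2 ^^ 5 = id" "y\<^sub>2 ^^ 5 = id" "z\<^sub>2 ^^ 5 = id"
    unfolding generator_defs by (rule five; simp)+
qed

lemma generator_orders:
  "group.ord (alt_group 6) x\<^sub>1 = 4" "group.ord (alt_group 6) y\<^sub>1 = 4" "group.ord (alt_group 6) z\<^sub>1 = 4"
  "group.ord (alt_group 6) x\<^sub>2 = 5" "group.ord (alt_group 6) y\<^sub>2 = 5" "group.ord (alt_group 6) z\<^sub>2 = 5"
proof -
  have four: "group.ord (alt_group 6) p = 4"
    if "p \<in> carrier (alt_group 6)" "p ^^ 4 = id" "(p \<circ> p) i \<noteq> i" for p i
  proof -
    have "p ^^ 2 \<noteq> id"
      using that(3) by (auto simp: numeral_2_eq_2 fun_eq_iff)
    then show ?thesis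
      using group.ord_eq_prime_power[OF alt_group_is_group that(1), of 2 1] that(2)
      by (simp add: alt_group_nat_pow alt_group_one)
  qed
  have five: "group.ord (alt_group 6) p = 5"
    if "p \<in> carrier (alt_group 6)" "p ^^ 5 = id" "p 1 \<noteq> 1" for p
  proof -
    have "p \<noteq> id"
      using that(3) by auto
    then show ?thesis
      using group.ord_eq_prime_power[OF alt_group_is_group that(1), of 5 0] that(2)
      by (simp add: alt_group_nat_pow alt_group_one alt_group_mult)
  qed
  show "group.ord (alt_group 6) x\<^sub>1 = 4" "group.ord (alt_group 6) y\<^sub>1 = 4" "group.ord (alt_group 6) z\<^sub>1 = 4"
    \<comment> \<open>The index given to \<open>four\<close> after the permutation is a point on a cycle of length four, which the square moves.\<close>
    using four[of x\<^sub>1 3] four[of y\<^sub>1 2] four[of z\<^sub>1 1] fourth_powers generators_carrier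
    by (simp_all add: generator_tables)
  show "group.ord (alt_group 6) x\<^sub>2 = 5" "group.ord (alt_group 6) y\<^sub>2 = 5" "group.ord (alt_group 6) z\<^sub>2 = 5"
    using five fifth_powers generators_carrier by (simp_all add: generator_tables)
qed

lemma (in group) conj_nat_pow:
  assumes "g \<in> carrier G" "a \<in> carrier G"
  shows "(g \<otimes> a \<otimes> inv g) [^] (k::nat) = g \<otimes> a [^] k \<otimes> inv g"
proof (induction k)
  case 0
  then show ?case using assms by simp
next
  case (Suc k)
  have "inv g \<otimes> (g \<otimes> (a \<otimes> inv g)) = a \<otimes> inv g"
    using assms by (simp add: m_assoc[symmetric])
  then show ?case using assms Suc by (simp add: m_assoc)
qed

lemma (in group) Sigma_pow_eq_one:
  assumes "w \<in> beauville_Sigma G (x, y, z)" "{x, y, z} \<subseteq> carrier G"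
    and "\<And>a. a \<in> {x, y, z} \<Longrightarrow> ord a dvd m"
  shows "w \<in> carrier G" "w [^] m = \<one>"
proof -
  obtain g a and j :: nat where w: "g \<in> carrier G" "a \<in> {x, y, z}" "w = g \<otimes> a [^] j \<otimes> inv g"
    using assms(1) by (auto simp: beauville_Sigma_def)
  with assms(2) have a: "a \<in> carrier G" by blast
  show "w \<in> carrier G"
    using w a by simp
  have "(a [^] j) [^] m = (a [^] m) [^] j"
    using a by (simp add: nat_pow_pow mult.commute)
  moreover have "a [^] m = \<one>"
    using assms(3) w(2) a pow_eq_id by blast
  ultimately show "w [^] m = \<one>"
    using w a by (simp add: conj_nat_pow)
qed

lemma (in group) one_in_Sigma: "{x, y, z} \<subseteq> carrier G \<Longrightarrow> \<one> \<in> beauville_Sigma G (x, y, z)"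
  unfolding beauville_Sigma_def by (auto intro!: bexI[of _ \<one>] exI[of _ "0::nat"])

text \<open>A common element has order dividing both \<open>m\<close> and \<open>n\<close>.\<close>

lemma (in group) Sigma_inter_coprime:
  assumes "{x, y, z} \<subseteq> carrier G" "{x', y', z'} \<subseteq> carrier G"
    and "\<And>a. a \<in> {x, y, z} \<Longrightarrow> ord a dvd m" "\<And>a. a \<in> {x', y', z'} \<Longrightarrow> ord a dvd n"
    and "coprime m n"
  shows "beauville_Sigma G (x, y, z) \<inter> beauville_Sigma G (x', y', z') = {\<one>}"
proof -
  have "w = \<one>" if "w \<in> beauville_Sigma G (x, y, z)" "w \<in> beauville_Sigma G (x', y', z')" for w
  proof -
    have w: "w \<in> carrier G"
      using Sigma_pow_eq_one(1)[OF that(1) assms(1)] assms(3) by blast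
    have "w [^] m = \<one>" "w [^] n = \<one>"
      using Sigma_pow_eq_one(2)[OF that(1) assms(1,3)] Sigma_pow_eq_one(2)[OF that(2) assms(2,4)]
      by blast+
    then have "ord w dvd m" "ord w dvd n"
      using w by (simp_all add: pow_eq_id)
    then have "ord w = 1"
      using assms(5) by (metis coprime_common_divisor_nat)
    then show ?thesis
      using w ord_eq_1 by blast
  qed
  then show ?thesis
    using one_in_Sigma assms(1,2) by blast
qed

section \<open>The Beauville structure\<close>

theorem theorem9:
  shows "\<exists>B. unmixed_beauville_structure (alt_group 6) B \<and>
             strongly_real (alt_group 6) B \<and>
             structure_type (alt_group 6) B = ((4, 4, 4), (5, 5, 5))"
proof (intro exI conjI)
  let ?G = "alt_group 6" and ?B = "((x\<^sub>1, y\<^sub>1, z\<^sub>1), (x\<^sub>2, y\<^sub>2, z\<^sub>2))"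
  interpret group ?G by (rule alt_group_is_group)
  have gen: "generate ?G {x\<^sub>1, y\<^sub>1, z\<^sub>1} = carrier ?G" "generate ?G {x\<^sub>2, y\<^sub>2, z\<^sub>2} = carrier ?G"
    using mono_generate[of "{x\<^sub>1, y\<^sub>1}" "{x\<^sub>1, y\<^sub>1, z\<^sub>1}"] mono_generate[of "{x\<^sub>2, y\<^sub>2}" "{x\<^sub>2, y\<^sub>2, z\<^sub>2}"]
      generate_incl[of "{x\<^sub>1, y\<^sub>1, z\<^sub>1}"] generate_incl[of "{x\<^sub>2, y\<^sub>2, z\<^sub>2}"]
      generate_first generate_second generators_carrier by auto
  have "finite (carrier ?G)"
    by (rule finite_subset[OF _ finite_permutations[of "{1..6}"]]) (auto simp: alt_group_carrier)
  moreover have "beauville_Sigma ?G (x\<^sub>1, y\<^sub>1, z\<^sub>1) \<inter> beauville_Sigma ?G (x\<^sub>2, y\<^sub>2, z\<^sub>2) = {\<one>\<^bsub>?G\<^esub>}"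
    by (rule Sigma_inter_coprime[where m = 4 and n = 5])
      (use generators_carrier generator_orders coprime_Suc_right_nat[of 4] in auto)
  ultimately show "unmixed_beauville_structure ?G ?B"
    using gen generators_carrier generator_orders generator_products is_group
    by (simp add: unmixed_beauville_structure_def hyperbolic_generating_triple_def
        alt_group_mult alt_group_one)
  show "strongly_real ?G ?B"
    using exotic_in_auto auto_eq_inner_mult_self[OF exotic_in_auto] exotic_inverts
    by (auto simp: strongly_real_def)
  show "structure_type ?G ?B = ((4, 4, 4), (5, 5, 5))"
    by (simp add: structure_type_def triple_type_def generator_orders)
qed

end
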